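(* Let $G$ be a locally pseudocompact group, with completion $\widetilde G$. Then $G$ is locally connected if and only if $\widetilde G$ is locally connected.
   Context: All topological spaces and topological groups are assumed to be Tychonoff (in particular Hausdorff); groups need not be abelian. A space is pseudocompact if every continuous real-valued function on it is bounded. A topological group $G$ is locally pseudocompact if there is an open neighborhood $U$ of the identity such that $\operatorname{cl}_G U$ is pseudocompact. Every locally pseudocompact group $G$ is locally precompact, i.e., it embeds as a dense topological subgroup of a locally compact group $\widetilde G$, unique up to topological isomorphism fixing $G$; $\widetilde G$ is called the completion of $G$ (it is also the two-sided, Raĭkov, completion). A space $X$ is locally connected if each connected component of every open subspace of $X$ is open. *)

theory Defs
  imports "HOL-Analysis.Analysis" "HOL-Algebra.Group"
begin

definition tychonoff_space :: "'a topology \<Rightarrow> bool"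
  where "tychonoff_space X \<longleftrightarrow> completely_regular_space X \<and> Hausdorff_space X"

definition pseudocompact_space :: "'a topology \<Rightarrow> bool"
  where "pseudocompact_space X \<longleftrightarrow>
    (\<forall>f. continuous_map X euclideanreal f \<longrightarrow> bounded (f ` topspace X))"

text \<open>Topological groups, not necessarily abelian, are Tychonoff by convention.\<close>

locale topological_group = group G for G (structure) +
  fixes T :: "'a topology"
  assumes topspace_eq_carrier: "topspace T = carrier G"
    and continuous_mult: "continuous_map (prod_topology T T) T (\<lambda>(x, y). x \<otimes> y)"
    and continuous_inv: "continuous_map T T (\<lambda>x. inv x)"
    and tychonoff: "tychonoff_space T"

locale locally_pseudocompact_group = topological_group +
  assumes locally_pseudocompact:
    "\<exists>U. openin T U \<and> \<one> \<in> U \<and> pseudocompact_space (subtopology T (T closure_of U))"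

text \<open>
  A completion of the group \<open>G\<close> is a locally compact group \<open>H\<close> together with a map \<open>e\<close>
  identifying \<open>G\<close> with a dense topological subgroup of \<open>H\<close>. Completions are unique only
  up to topological isomorphism, so this is a relation rather than a chosen object.
\<close>

locale group_completion =
  G: topological_group G T + H: topological_group H S
  for G :: "('a, 'c) monoid_scheme" and T :: "'a topology"
    and H :: "('b, 'd) monoid_scheme" and S :: "'b topology" +
  fixes e :: "'a \<Rightarrow> 'b"
  assumes locally_compact: "locally_compact_space S"
    and hom: "e \<in> hom G H"
    and embedding: "embedding_map T S e"
    and dense: "S closure_of (e ` carrier G) = carrier H"

text \<open>
  For local connectedness we use the library's \<^const>\<open>locally_connected_space\<close>; the
  formulation by open connected components of open subspaces is the library fact
  \<open>locally_connected_space_open_connected_components\<close>.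
\<close>

end

theory Submission
  imports Defs
begin

text \<open>
  If the group is locally connected, closures in the completion of small connected neighbourhoods
  of the identity are small connected neighbourhoods there, and translations do the rest.

  Conversely, local pseudocompactness makes the group meet every nonempty \<open>G\<^sub>\<delta>\<close> of the
  completion, and this forces \<open>U \<inter> G\<close> to be connected for every connected open set \<open>U\<close> of the
  completion. Indeed, if \<open>U \<inter> G\<close> is split by disjoint open sets \<open>A\<close> and \<open>B\<close>, some \<open>p \<in> U\<close> lies in
  both closures. Choose neighbourhoods \<open>V\<^sub>n\<close> of the identity shrinking to a compact subgroup \<open>N\<close>,
  and points \<open>a\<^sub>n \<in> A\<close> and \<open>b\<^sub>n \<in> B\<close> in \<open>p V\<^sub>n\<close> whose cosets \<open>a\<^sub>n N\<close>, \<open>b\<^sub>n N\<close> still lie in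
  \<open>A\<close> and \<open>B\<close>. The coset \<open>p N\<close> contains a group element \<open>g\<close>, say \<open>g \<in> A\<close>. Then \<open>A N\<close> is an open set
  containing \<open>g N = p N\<close>, so by compactness it contains some \<open>b\<^sub>n\<close>, and \<open>b\<^sub>n N\<close> meets \<open>A\<close>,
  although it lies in \<open>B\<close>.
\<close>

section \<open>Zero sets in completely regular spaces\<close>

text \<open>Functions vanishing at \<open>p\<close> and equal to 1 off \<open>P n\<close> are summed
  with weights \<open>(1/2)^n\<close>. The Weierstrass test gives continuity, and a vanishing sum of
  nonnegative terms has every term zero.\<close>

lemma completely_regular_space_zero_set_in_G_delta:
  fixes P :: "nat \<Rightarrow> 'a set"
  assumes "completely_regular_space X" "\<And>n. openin X (P n)" "\<And>n. p \<in> P n"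
  obtains F where "continuous_map X euclideanreal F" "F p = (0::real)"
    "\<And>x. x \<in> topspace X \<Longrightarrow> 0 \<le> F x"
    "\<And>x n. x \<in> topspace X \<Longrightarrow> F x = 0 \<Longrightarrow> x \<in> P n"
proof -
  have "\<exists>f. continuous_map X (top_of_set {0..1::real}) f \<and> f p = 0 \<and> f ` (topspace X - P n) \<subseteq> {1}" for n
  proof -
    have "closedin X (topspace X - P n)" "p \<in> topspace X - (topspace X - P n)"
      using assms(2,3)[of n] openin_subset by auto
    then show ?thesis
      using assms(1) unfolding completely_regular_space_def by presburger
  qed
  then obtain f where contf: "\<And>n. continuous_map X (top_of_set {0..1::real}) (f n)"
    and fp: "\<And>n. f n p = 0" and f1: "\<And>n. f n ` (topspace X - P n) \<subseteq> {1}"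
    by metis
  have f01: "0 \<le> f n x" "f n x \<le> 1" if "x \<in> topspace X" for n x
    using contf[of n] that by (auto simp: continuous_map_in_subtopology)
  have contf': "continuous_map X euclideanreal (f n)" for n
    using contf continuous_map_in_subtopology by blast
  define F where "F x = (\<Sum>n. f n x * (1/2)^n)" for x
  have half: "summable (\<lambda>n. (1/2)^n :: real)"
    by (simp add: summable_geometric)
  have summ: "summable (\<lambda>n. f n x * (1/2)^n)" if "x \<in> topspace X" for x
    by (rule summable_comparison_test'[OF half])
       (use f01[OF that] in \<open>auto simp: abs_mult intro!: mult_left_le_one_le\<close>)
  have lim: "uniform_limit (topspace X) (\<lambda>n x. \<Sum>i<n. f i x * (1/2)^i) F sequentially"
    unfolding F_def
    by (rule Weierstrass_m_test[OF _ half])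
       (use f01 in \<open>auto simp: abs_mult intro!: mult_left_le_one_le\<close>)
  show ?thesis
  proof
    have "continuous_map X Met_TC.mtopology F"
    proof (rule Met_TC.continuous_map_uniform_limit)
      show "\<forall>\<^sub>F n in sequentially. continuous_map X Met_TC.mtopology (\<lambda>x. \<Sum>i<n. f i x * (1/2)^i)"
        unfolding mtopology_is_euclidean
        by (intro always_eventually allI continuous_map_sum continuous_map_real_mult contf') auto
      show "\<forall>\<^sub>F n in sequentially. \<forall>x\<in>topspace X. F x \<in> UNIV \<and>
          dist (\<Sum>i<n. f i x * (1/2)^i) (F x) < \<epsilon>" if "0 < \<epsilon>" for \<epsilon>
        using uniform_limitD[OF lim that] by simp
    qed simp
    then show "continuous_map X euclideanreal F"
      by simp
    show "F p = 0"
      by (simp add: F_def fp)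
    show "0 \<le> F x" if "x \<in> topspace X" for x
      unfolding F_def by (intro suminf_nonneg summ that) (use f01[OF that] in auto)
    show "x \<in> P n" if x: "x \<in> topspace X" and "F x = 0" for x n
    proof -
      have "f n x * (1/2)^n = 0"
        using suminf_eq_zero_iff[OF summ[OF x]] f01[OF x] \<open>F x = 0\<close> by (auto simp: F_def)
      then show ?thesis
        using f1[of n] x by force
    qed
  qed
qed

lemma in_closure_of_meets_open:
  assumes "x \<in> X closure_of S" "openin X W" "x \<in> W"
  shows "S \<inter> W \<noteq> {}"
  using assms by (auto simp: in_closure_of)

section \<open>Neighbourhoods and translations in topological groups\<close>

context topological_group
begin

lemma continuous_map_mult:
  assumes "continuous_map X T f" "continuous_map X T g"
  shows "continuous_map X T (\<lambda>x. f x \<otimes> g x)"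
proof -
  have "continuous_map X (prod_topology T T) (\<lambda>x. (f x, g x))"
    using assms by (simp add: continuous_map_paired)
  from continuous_map_compose[OF this continuous_mult] show ?thesis
    by (simp add: o_def)
qed

lemma continuous_map_inv:
  assumes "continuous_map X T f"
  shows "continuous_map X T (\<lambda>x. inv (f x))"
  using continuous_map_compose[OF assms continuous_inv] by (simp add: o_def)

lemma continuous_map_const_carrier: "a \<in> carrier G \<Longrightarrow> continuous_map X T (\<lambda>x. a)"
  by (simp add: topspace_eq_carrier)

lemmas group_continuous_intros =
  continuous_map_mult continuous_map_inv continuous_map_const_carrier

lemma openin_preimage:
  assumes "continuous_map T T f" "openin T U"
  shows "openin T {x \<in> carrier G. f x \<in> U}"
  using openin_continuous_map_preimage[OF assms] by (simp add: topspace_eq_carrier)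

lemma openin_subset_carrier: "openin T U \<Longrightarrow> U \<subseteq> carrier G"
  using openin_subset topspace_eq_carrier by blast

lemma openin_left_translate:
  assumes "a \<in> carrier G" "openin T U"
  shows "openin T ((\<lambda>x. a \<otimes> x) ` U)"
proof -
  have "(\<lambda>x. a \<otimes> x) ` U = {x \<in> carrier G. inv a \<otimes> x \<in> U}" (is "?L = ?R")
  proof
    show "?L \<subseteq> ?R"
      using assms openin_subset_carrier[OF assms(2)] by (auto simp: m_assoc[symmetric])
    show "?R \<subseteq> ?L"
    proof
      fix x assume "x \<in> ?R"
      then have "x = a \<otimes> (inv a \<otimes> x)" "inv a \<otimes> x \<in> U"
        using assms(1) by (auto simp: m_assoc[symmetric])
      then show "x \<in> ?L" by blast
    qed
  qed
  then show ?thesis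
    using assms by (auto intro!: openin_preimage group_continuous_intros)
qed

lemma completely_regular: "completely_regular_space T"
  and Hausdorff: "Hausdorff_space T"
  using tychonoff by (auto simp: tychonoff_space_def)

text \<open>This is continuity of \<open>(x, y) \<mapsto> inv x \<otimes> y\<close> at the pair of
  identities.\<close>

lemma division_neighbourhood:
  assumes "openin T U" "\<one> \<in> U"
  obtains V where "openin T V" "\<one> \<in> V" "V \<subseteq> U" "\<And>x y. x \<in> V \<Longrightarrow> y \<in> V \<Longrightarrow> inv x \<otimes> y \<in> U"
proof -
  have c: "continuous_map (prod_topology T T) T (\<lambda>z. inv (fst z) \<otimes> snd z)"
    by (intro continuous_map_mult continuous_map_inv continuous_map_fst continuous_map_snd)
  let ?S = "{z \<in> topspace (prod_topology T T). inv (fst z) \<otimes> snd z \<in> U}"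
  have S: "openin (prod_topology T T) ?S"
    using openin_continuous_map_preimage[OF c assms(1)] .
  have "(\<one>, \<one>) \<in> ?S"
    using assms by (simp add: topspace_eq_carrier)
  from S[unfolded openin_prod_topology_alt, rule_format, OF this]
  obtain V W where VW: "openin T V" "openin T W" "\<one> \<in> V" "\<one> \<in> W" and *: "V \<times> W \<subseteq> ?S"
    by (elim exE conjE)
  show ?thesis
  proof
    show "openin T (V \<inter> W \<inter> U)" "\<one> \<in> V \<inter> W \<inter> U" "V \<inter> W \<inter> U \<subseteq> U"
      using VW assms by auto
    show "inv x \<otimes> y \<in> U" if "x \<in> V \<inter> W \<inter> U" "y \<in> V \<inter> W \<inter> U" for x y
      using * that by auto
  qed
qed

text \<open>For \<open>z\<close> in the closure, the translate of \<open>V\<close> by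
  \<open>z\<close> on the right is a neighbourhood of \<open>z\<close> and so meets \<open>V\<close>
  in some \<open>w\<close>; then \<open>z\<close> is the quotient of
  \<open>w \<otimes> inv z\<close> and \<open>w\<close>, both in \<open>V\<close>.\<close>

lemma closure_of_division_neighbourhood:
  assumes "openin T V" "\<one> \<in> V" "\<And>x y. x \<in> V \<Longrightarrow> y \<in> V \<Longrightarrow> inv x \<otimes> y \<in> U"
  shows "T closure_of V \<subseteq> U"
proof
  fix z assume z: "z \<in> T closure_of V"
  then have zc: "z \<in> carrier G"
    using closure_of_subset_topspace[of T V] topspace_eq_carrier by auto
  have "openin T {x \<in> carrier G. x \<otimes> inv z \<in> V}"
    using zc assms(1) by (intro openin_preimage group_continuous_intros) auto
  moreover have "z \<in> {x \<in> carrier G. x \<otimes> inv z \<in> V}"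
    using zc assms(2) by simp
  ultimately obtain w where w: "w \<in> V" "w \<in> carrier G" "w \<otimes> inv z \<in> V"
    using in_closure_of_meets_open[OF z, of "{x \<in> carrier G. x \<otimes> inv z \<in> V}"] by auto
  have "inv (w \<otimes> inv z) \<otimes> w = z"
    using w zc by (simp add: inv_mult_group m_assoc)
  then show "z \<in> U"
    using assms(3)[OF w(3,1)] by simp
qed

section \<open>Local connectedness from a dense subset\<close>

text \<open>The closure of a connected set is connected but perhaps not open, so connectedness im
  kleinen is verified instead: at the identity by closures, elsewhere by translation.\<close>

lemma locally_connected_if_dense_subset:
  assumes D: "D \<subseteq> carrier G" "\<one> \<in> D" "T closure_of D = carrier G"
    and lc: "locally_connected_space (subtopology T D)"
  shows "locally_connected_space T"
  unfolding locally_connected_space_im_kleinen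
proof (intro strip)
  fix V x assume V: "openin T V \<and> x \<in> V"
  then have x: "x \<in> carrier G"
    using openin_subset_carrier by blast
  have "openin T {y \<in> carrier G. x \<otimes> y \<in> V}"
    using V x by (intro openin_preimage group_continuous_intros) auto
  moreover have "\<one> \<in> {y \<in> carrier G. x \<otimes> y \<in> V}"
    using V x by simp
  \<comment> \<open>Regularity supplies a closed \<open>C\<close>, which will also contain the
    closure of the connected set found inside \<open>U\<close>.\<close>
  moreover have "neighbourhood_base_of (closedin T) T"
    by (simp add: neighbourhood_base_of_closedin completely_regular_imp_regular_space completely_regular)
  ultimately obtain U C where U: "openin T U" "closedin T C" "\<one> \<in> U" "U \<subseteq> C"
    and C: "C \<subseteq> {y \<in> carrier G. x \<otimes> y \<in> V}"
    unfolding neighbourhood_base_of by meson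
  have "openin (subtopology T D) (U \<inter> D)"
    using U by (auto simp: openin_subtopology)
  then obtain W' where W': "openin (subtopology T D) W'" "connectedin (subtopology T D) W'"
    "\<one> \<in> W'" "W' \<subseteq> U \<inter> D"
    using lc U D unfolding locally_connected_space by (metis IntI)
  then obtain W where W: "openin T W" "W' = W \<inter> D"
    by (auto simp: openin_subtopology)
  let ?C = "T closure_of W'"
  have con: "connectedin T ?C"
    using W'(2) by (intro connectedin_closure_of) (simp add: connectedin_subtopology)
  have "?C \<subseteq> C"
    using W' U by (intro closure_of_minimal) auto
  then have CV: "(\<lambda>y. x \<otimes> y) ` ?C \<subseteq> V"
    using C by auto
  have "W \<subseteq> ?C"
    using openin_Int_closure_of_subset[OF W(1), of D] D W openin_subset_carrier[OF W(1)] by auto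
  moreover have "connectedin T ((\<lambda>y. x \<otimes> y) ` ?C)"
    using con x by (intro connectedin_continuous_map_image group_continuous_intros) auto
  moreover have "x \<in> (\<lambda>y. x \<otimes> y) ` W"
    using W W' x by (force intro: image_eqI[where x = "\<one>"])
  moreover have "openin T ((\<lambda>y. x \<otimes> y) ` W)"
    using W x by (intro openin_left_translate)
  ultimately show "\<exists>U. openin T U \<and> x \<in> U \<and> U \<subseteq> V \<and>
      (\<forall>y\<in>U. \<exists>C. connectedin T C \<and> C \<subseteq> V \<and> x \<in> C \<and> y \<in> C)"
    using CV by (intro exI[where x = "(\<lambda>y. x \<otimes> y) ` W"]) blast
qed

section \<open>Connected traces on a G-delta-dense subset\<close>

lemma separated_closures_if_G_delta_dense:
  assumes lc: "locally_compact_space T"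
    and Gd: "\<And>p P. p \<in> carrier G \<Longrightarrow> (\<And>n::nat. openin T (P n) \<and> p \<in> P n) \<Longrightarrow> \<exists>g\<in>D. \<forall>n. g \<in> P n"
    and op: "openin T U" "openin T A" "openin T B"
    and AB: "A \<inter> B = {}" "U \<inter> D \<subseteq> A \<union> B"
  shows "U \<inter> T closure_of A \<inter> T closure_of B = {}"
proof (rule ccontr)
  assume "\<not> ?thesis"
  then obtain p where pU: "p \<in> U" and pA: "p \<in> T closure_of A" and pB: "p \<in> T closure_of B"
    by blast
  have p: "p \<in> carrier G"
    using op pU openin_subset_carrier by blast
  \<comment> \<open>The neighbourhood \<open>W\<close> allows the next stage to be so small that its
    translate by \<open>a\<close> stays in \<open>E\<close>.\<close>
  have near: "\<exists>a\<in>carrier G. inv p \<otimes> a \<in> V \<and> (\<exists>W. openin T W \<and> \<one> \<in> W \<and> (\<forall>v\<in>W. a \<otimes> v \<in> E))"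
    if "openin T V" "\<one> \<in> V" "openin T E" and pE: "p \<in> T closure_of E" for V E
  proof -
    have "openin T {x \<in> carrier G. inv p \<otimes> x \<in> V}"
      using p that by (intro openin_preimage group_continuous_intros) auto
    moreover have "p \<in> {x \<in> carrier G. inv p \<otimes> x \<in> V}"
      using p that by simp
    ultimately obtain a where a: "a \<in> E" "a \<in> carrier G" "inv p \<otimes> a \<in> V"
      using in_closure_of_meets_open[OF pE, of "{x \<in> carrier G. inv p \<otimes> x \<in> V}"] by auto
    have "openin T {x \<in> carrier G. a \<otimes> x \<in> E}"
      using a that by (intro openin_preimage group_continuous_intros) auto
    then show ?thesis
      using a by (intro bexI[of _ a] conjI exI[of _ "{x \<in> carrier G. a \<otimes> x \<in> E}"]) auto
  qed
  obtain O1 K where K: "openin T O1" "compactin T K" "p \<in> O1" "O1 \<subseteq> K"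
    using lc p unfolding locally_compact_space_def topspace_eq_carrier by meson
  \<comment> \<open>\<open>?P\<close> keeps the translate of \<open>V\<close> by \<open>p\<close>
    inside \<open>U\<close> and the compact set \<open>K\<close>. In \<open>?Q\<close>, the division
    condition makes the intersection \<open>N\<close> of the stages a subgroup, and
    \<open>?R\<close> yields points near \<open>p\<close> whose cosets of \<open>N\<close> stay in
    \<open>A\<close> or in \<open>B\<close>.\<close>
  let ?P = "\<lambda>V. openin T V \<and> \<one> \<in> V \<and> (\<forall>v\<in>V. p \<otimes> v \<in> U \<inter> O1)"
  let ?R = "\<lambda>E V V'. \<exists>a\<in>carrier G. inv p \<otimes> a \<in> V \<and> (\<forall>v\<in>V'. a \<otimes> v \<in> E)"
  let ?Q = "\<lambda>V V'. V' \<subseteq> V \<and> (\<forall>x\<in>V'. \<forall>y\<in>V'. inv x \<otimes> y \<in> V) \<and> ?R A V V' \<and> ?R B V V'"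
  have "\<exists>V. \<forall>n. ?P (V n) \<and> ?Q (V n) (V (Suc n))"
  proof (rule dependent_nat_choice)
    have "openin T {v \<in> carrier G. p \<otimes> v \<in> U \<inter> O1}"
      using p op K by (intro openin_preimage group_continuous_intros) auto
    then show "\<exists>V. ?P V"
      using p K pU by (intro exI[of _ "{v \<in> carrier G. p \<otimes> v \<in> U \<inter> O1}"]) auto
    show "\<exists>V'. ?P V' \<and> ?Q V V'" if V: "?P V" for V and n :: nat
    proof -
      obtain V1 where V1: "openin T V1" "\<one> \<in> V1" "V1 \<subseteq> V"
        "\<And>x y. x \<in> V1 \<Longrightarrow> y \<in> V1 \<Longrightarrow> inv x \<otimes> y \<in> V"
        using V division_neighbourhood by metis
      obtain a W1 where a: "a \<in> carrier G" "inv p \<otimes> a \<in> V" "openin T W1" "\<one> \<in> W1"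
        "\<forall>v\<in>W1. a \<otimes> v \<in> A"
        using near[of V A] V op pA by blast
      obtain b W2 where b: "b \<in> carrier G" "inv p \<otimes> b \<in> V" "openin T W2" "\<one> \<in> W2"
        "\<forall>v\<in>W2. b \<otimes> v \<in> B"
        using near[of V B] V op pB by blast
      let ?V = "V1 \<inter> W1 \<inter> W2"
      have "?P ?V"
        using V V1 a b by auto
      moreover have "?R A V ?V" "?R B V ?V"
        using a b by blast+
      moreover have "?V \<subseteq> V \<and> (\<forall>x\<in>?V. \<forall>y\<in>?V. inv x \<otimes> y \<in> V)"
        using V1 by blast
      ultimately show ?thesis by blast
    qed
  qed
  then obtain V where V: "\<forall>n. ?P (V n) \<and> ?Q (V n) (V (Suc n))" ..
  have Vop: "openin T (V n)" and V1: "\<one> \<in> V n" and VU: "v \<in> V n \<Longrightarrow> p \<otimes> v \<in> U \<inter> O1"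
    and VSuc: "V (Suc n) \<subseteq> V n"
    and Vdiv: "x \<in> V (Suc n) \<Longrightarrow> y \<in> V (Suc n) \<Longrightarrow> inv x \<otimes> y \<in> V n" for n v x y
    using spec[OF V, of n] by simp_all
  have VA: "?R A (V n) (V (Suc n))" and VB: "?R B (V n) (V (Suc n))" for n
    using spec[OF V, of n] by simp_all
  have Vc: "V n \<subseteq> carrier G" for n
    using Vop openin_subset_carrier by blast
  have dec: "V n \<subseteq> V m" if "m \<le> n" for m n
    using lift_Suc_antimono_le[of V] VSuc that by blast
  define N where "N = (\<Inter>n. V n)"
  have Nc: "N \<subseteq> carrier G"
    using Vc by (auto simp: N_def)
  have Ndiv: "inv x \<otimes> y \<in> N" if "x \<in> N" "y \<in> N" for x y
    using Vdiv that unfolding N_def by blast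
  have clV: "T closure_of (V (Suc n)) \<subseteq> V n" for n
    using Vop V1 Vdiv by (rule closure_of_division_neighbourhood)
  \<comment> \<open>The coset of \<open>N\<close> through \<open>p\<close> is a G-delta containing
    \<open>p\<close>, so it contains a point of \<open>D\<close>.\<close>
  have "\<exists>g\<in>D. \<forall>n. g \<in> {x \<in> carrier G. inv p \<otimes> x \<in> V n}"
  proof (rule Gd[OF p])
    fix n
    show "openin T {x \<in> carrier G. inv p \<otimes> x \<in> V n} \<and> p \<in> {x \<in> carrier G. inv p \<otimes> x \<in> V n}"
      using p Vop V1 by (auto intro!: openin_preimage group_continuous_intros)
  qed
  then obtain g where g: "g \<in> D" "g \<in> carrier G" "inv p \<otimes> g \<in> N"
    by (auto simp: N_def)
  \<comment> \<open>To be used with \<open>E\<close> the one of \<open>A\<close> and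
    \<open>B\<close> that contains \<open>g\<close>, and \<open>F\<close> the other.\<close>
  have contra: False
    if E: "openin T E" "E \<inter> F = {}" "g \<in> E" and R: "\<And>n. ?R F (V n) (V (Suc n))" for E F
  proof -
    \<comment> \<open>\<open>Q\<close> is \<open>E N\<close>, as \<open>N\<close> is closed under inverses.\<close>
    define Q where "Q = (\<Union>v\<in>N. {z \<in> carrier G. z \<otimes> v \<in> E})"
    define C where "C n = K \<inter> {x \<in> carrier G. inv p \<otimes> x \<in> T closure_of (V n)} - Q" for n
    have "openin T Q"
      unfolding Q_def using Nc E by (intro openin_Union ballI) (auto intro!: openin_preimage group_continuous_intros)
    have "continuous_map T T (\<lambda>x. inv p \<otimes> x)"
      using p by (intro group_continuous_intros) auto
    then have closed: "closedin T {x \<in> carrier G. inv p \<otimes> x \<in> T closure_of (V n)}" for n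
      using closedin_continuous_map_preimage[of T T] topspace_eq_carrier by force
    have "closedin T K"
      using K Hausdorff compactin_imp_closedin by blast
    then have Ccl: "closedin T (C n)" for n
      unfolding C_def using closed \<open>openin T Q\<close> by auto
    have Cne: "C n \<noteq> {}" for n
    proof -
      obtain b where b: "b \<in> carrier G" "inv p \<otimes> b \<in> V n" "\<forall>v\<in>V (Suc n). b \<otimes> v \<in> F"
        using R by blast
      have "p \<otimes> (inv p \<otimes> b) \<in> O1"
        using b VU dec[of 0 n] by blast
      then have "b \<in> K"
        using b p K by (auto simp: m_assoc[symmetric])
      \<comment> \<open>The coset of \<open>N\<close> through \<open>b\<close> lies in
        \<open>F\<close>, since \<open>N\<close> is contained in \<open>V (Suc n)\<close>, and so
        misses \<open>E\<close>.\<close>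
      moreover have "b \<notin> Q"
        using b E unfolding Q_def N_def by blast
      moreover have "inv p \<otimes> b \<in> T closure_of (V n)"
        using b closure_of_subset[of "V n" T] Vc topspace_eq_carrier by auto
      ultimately show ?thesis
        using b unfolding C_def by blast
    qed
    have "decseq C"
      unfolding C_def decseq_def using dec closure_of_mono by blast
    moreover have "compact_space (subtopology T K)"
      using K compact_space_subtopology by blast
    moreover have "closedin (subtopology T K) (C n)" for n
      using Ccl by (intro closedin_subset_topspace) (auto simp: C_def)
    ultimately have "(\<Inter>n. C n) \<noteq> {}"
      using Cne compact_space_imp_nest by blast
    then obtain z where z: "\<And>n. z \<in> C n" by blast
    then have zc: "z \<in> carrier G" and "z \<notin> Q" and "\<And>n. inv p \<otimes> z \<in> T closure_of (V n)"
      by (auto simp: C_def)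
    then have "inv p \<otimes> z \<in> N"
      using clV unfolding N_def by blast
    \<comment> \<open>\<open>z\<close> and \<open>g\<close> lie in the same coset of
      \<open>N\<close>, so an element of \<open>N\<close> carries \<open>z\<close> to
      \<open>g\<close>, which is in \<open>E\<close>.\<close>
    then have "inv (inv p \<otimes> z) \<otimes> (inv p \<otimes> g) \<in> N"
      using g Ndiv by blast
    moreover have "z \<otimes> (inv (inv p \<otimes> z) \<otimes> (inv p \<otimes> g)) = g"
    proof -
      have "inv (inv p \<otimes> z) \<otimes> (inv p \<otimes> g) = inv z \<otimes> (p \<otimes> (inv p \<otimes> g))"
        using zc p g by (simp add: inv_mult_group m_assoc)
      also have "\<dots> = inv z \<otimes> g"
        using p g by (simp add: m_assoc[symmetric])
      finally show ?thesis
        using zc g by (simp add: m_assoc[symmetric])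
    qed
    ultimately have "z \<in> Q"
      using zc E unfolding Q_def by force
    with \<open>z \<notin> Q\<close> show False by blast
  qed
  have "p \<otimes> (inv p \<otimes> g) \<in> U"
    using g VU by (auto simp: N_def)
  then have "g \<in> U"
    using g p by (auto simp: m_assoc[symmetric])
  then have "g \<in> A \<or> g \<in> B"
    using g AB by blast
  then show False
    using contra[OF op(2) AB(1) _ VB] contra[OF op(3) _ _ VA] AB(1) by (metis Int_commute)
qed

text \<open>The two pieces of a splitting of the trace have closures that do not meet inside
  \<open>U\<close>, so the splitting extends to all of \<open>U\<close>.\<close>

lemma connectedin_Int_G_delta_dense:
  assumes lc: "locally_compact_space T"
    and D: "T closure_of D = carrier G"
    and Gd: "\<And>p P. p \<in> carrier G \<Longrightarrow> (\<And>n::nat. openin T (P n) \<and> p \<in> P n) \<Longrightarrow> \<exists>g\<in>D. \<forall>n. g \<in> P n"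
    and U: "openin T U" "connectedin T U"
  shows "connectedin T (U \<inter> D)"
proof (rule ccontr)
  assume "\<not> ?thesis"
  then obtain A' B' where AB': "openin T A'" "openin T B'" "U \<inter> D \<subseteq> A' \<union> B'"
    "A' \<inter> B' \<inter> (U \<inter> D) = {}" "A' \<inter> (U \<inter> D) \<noteq> {}" "B' \<inter> (U \<inter> D) \<noteq> {}"
    using openin_subset[OF U(1)] unfolding connectedin by blast
  define A B where "A = A' \<inter> U" and "B = B' \<inter> U"
  have op: "openin T A" "openin T B"
    using AB' U by (auto simp: A_def B_def)
  \<comment> \<open>\<open>A\<close> and \<open>B\<close> are so far disjoint only on
    \<open>D\<close>; an open set missing a dense set is empty.\<close>
  have "(A \<inter> B) \<inter> T closure_of D = {} \<longleftrightarrow> (A \<inter> B) \<inter> D = {}"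
    using op by (intro openin_Int_closure_of_eq_empty) auto
  moreover have "(A \<inter> B) \<inter> D = {}"
    using AB' by (auto simp: A_def B_def)
  ultimately have disj: "A \<inter> B = {}"
    using D openin_subset_carrier[OF op(1)] by auto
  have cover: "U \<inter> D \<subseteq> A \<union> B"
    using AB' by (auto simp: A_def B_def)
  have Ucl: "U \<subseteq> T closure_of A \<union> T closure_of B"
  proof -
    have "U \<subseteq> T closure_of (U \<inter> D)"
      using openin_Int_closure_of_subset[OF U(1), of D] D openin_subset_carrier[OF U(1)] by auto
    also have "\<dots> \<subseteq> T closure_of (A \<union> B)"
      using cover by (rule closure_of_mono)
    finally show ?thesis by simp
  qed
  \<comment> \<open>\<open>?X\<close> contains \<open>B\<close> and \<open>?Y\<close> contains
    \<open>A\<close>. They are disjoint because, by density, the closures cover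
    \<open>U\<close>.\<close>
  let ?X = "U - T closure_of A" and ?Y = "U - T closure_of B"
  have "U \<inter> T closure_of A \<inter> T closure_of B = {}"
    by (rule separated_closures_if_G_delta_dense[OF lc Gd U(1) op disj cover])
  then have "U \<subseteq> ?X \<union> ?Y"
    by blast
  moreover have "?X \<inter> ?Y \<inter> U = {}"
    using Ucl by blast
  moreover have "openin T ?X" "openin T ?Y"
    using U by auto
  moreover have "A \<subseteq> ?Y" "B \<subseteq> ?X"
    using openin_Int_closure_of_eq_empty[OF op(1), of B] openin_Int_closure_of_eq_empty[OF op(2), of A] disj
    by (auto simp: A_def B_def)
  then have "?X \<inter> U \<noteq> {}" "?Y \<inter> U \<noteq> {}"
    using AB' by (auto simp: A_def B_def)
  ultimately show False
    using U(2) unfolding connectedin by blast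
qed

end

section \<open>G-delta-density of the group in its completion\<close>

text \<open>
  Otherwise a nonnegative continuous \<open>F\<close> that vanishes at \<open>p\<close>, and only inside the \<open>G\<^sub>\<delta>\<close>, would be
  positive on the group, and a translate of \<open>1 / F\<close> would be continuous but unbounded on the
  pseudocompact neighbourhood.
\<close>

lemma (in group_completion) G_delta_dense:
  assumes "locally_pseudocompact_group G T" and p: "p \<in> carrier H"
    and P: "\<And>n::nat. openin S (P n) \<and> p \<in> P n"
  shows "\<exists>g\<in>e ` carrier G. \<forall>n. g \<in> P n"
proof (rule ccontr)
  assume none: "\<not> ?thesis"
  interpret eh: group_hom G H e
    by unfold_locales (rule hom)
  obtain U where U: "openin T U" "\<one>\<^bsub>G\<^esub> \<in> U" "pseudocompact_space (subtopology T (T closure_of U))"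
    using locally_pseudocompact_group.locally_pseudocompact[OF assms(1)] by blast
  have "openin (subtopology S (e ` carrier G)) (e ` U)"
    using embedding U(1) homeomorphic_map_openness_eq
    unfolding embedding_map_def G.topspace_eq_carrier by blast
  then obtain U' where U': "openin S U'" "e ` U = U' \<inter> e ` carrier G"
    by (auto simp: openin_subtopology)
  have oneU': "\<one>\<^bsub>H\<^esub> \<in> U'"
    using U U' by (metis Int_iff eh.hom_one image_eqI)
  obtain F where F: "continuous_map S euclideanreal F" "F p = (0::real)"
    "\<And>x. x \<in> topspace S \<Longrightarrow> 0 \<le> F x" "\<And>x n. x \<in> topspace S \<Longrightarrow> F x = 0 \<Longrightarrow> x \<in> P n"
    using completely_regular_space_zero_set_in_G_delta[OF H.completely_regular] P by metis
  \<comment> \<open>The point \<open>p\<close> may lie far from \<open>U'\<close>. Density gives a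
    group element \<open>h\<close> whose inverse moves \<open>p\<close> to a point \<open>q\<close>
    of \<open>U'\<close>, where the translated function \<open>f\<close> vanishes.\<close>
  have "openin S {y \<in> carrier H. inv\<^bsub>H\<^esub> y \<otimes>\<^bsub>H\<^esub> p \<in> U'}"
    using p U' by (intro H.openin_preimage H.group_continuous_intros) auto
  moreover have "p \<in> {y \<in> carrier H. inv\<^bsub>H\<^esub> y \<otimes>\<^bsub>H\<^esub> p \<in> U'}"
    using p oneU' by simp
  ultimately obtain h where h: "h \<in> carrier G" "inv\<^bsub>H\<^esub> (e h) \<otimes>\<^bsub>H\<^esub> p \<in> U'"
    using in_closure_of_meets_open[of p S "e ` carrier G"] dense p by blast
  define q where "q = inv\<^bsub>H\<^esub> (e h) \<otimes>\<^bsub>H\<^esub> p"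
  have q: "q \<in> carrier H" "q \<in> U'" "e h \<otimes>\<^bsub>H\<^esub> q = p"
    using h p by (auto simp: q_def H.m_assoc[symmetric])
  define f where "f y = F (e h \<otimes>\<^bsub>H\<^esub> y)" for y
  have contf: "continuous_map S euclideanreal f"
    unfolding f_def using h
    by (intro continuous_map_compose[OF _ F(1), unfolded o_def] H.group_continuous_intros) auto
  have fpos: "0 < f (e x)" if "x \<in> carrier G" for x
  proof -
    have "f (e x) = F (e (h \<otimes>\<^bsub>G\<^esub> x))"
      using that h by (simp add: f_def)
    moreover have "F (e (h \<otimes>\<^bsub>G\<^esub> x)) \<noteq> 0" "0 \<le> F (e (h \<otimes>\<^bsub>G\<^esub> x))"
      using none F(3,4) that h G.m_closed[of h x] eh.hom_closed[of "h \<otimes>\<^bsub>G\<^esub> x"]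
    unfolding H.topspace_eq_carrier by blast+
    ultimately show ?thesis by simp
  qed
  have "continuous_map T S e"
    using embedding continuous_map_into_fulltopology homeomorphic_imp_continuous_map
    unfolding embedding_map_def by blast
  then have "continuous_map T euclideanreal (\<lambda>x. f (e x))"
    using continuous_map_compose[OF _ contf] by (auto simp: o_def)
  then have "continuous_map T euclideanreal (\<lambda>x. inverse (f (e x)))"
    using fpos by (intro continuous_map_real_inverse) (auto simp: G.topspace_eq_carrier less_le)
  then have "continuous_map (subtopology T (T closure_of U)) euclideanreal (\<lambda>x. inverse (f (e x)))"
    by (rule continuous_map_from_subtopology)
  then have "bounded ((\<lambda>x. inverse (f (e x))) ` topspace (subtopology T (T closure_of U)))"
    using U(3) unfolding pseudocompact_space_def by blast
  then obtain b where b: "b > 0" "\<And>x. x \<in> T closure_of U \<Longrightarrow> inverse (f (e x)) \<le> b"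
    unfolding bounded_pos using closure_of_subset_topspace[of T U] by (fastforce simp: abs_le_iff)
  \<comment> \<open>Near \<open>q\<close> the function \<open>f\<close> drops below
    \<open>inverse b\<close>; density gives such a point in the image of \<open>U\<close>, against
    the bound \<open>b\<close>.\<close>
  have "openin S (U' \<inter> {y \<in> topspace S. f y \<in> {..<inverse b}})"
    by (intro openin_Int U' openin_continuous_map_preimage[OF contf]) auto
  moreover have "q \<in> U' \<inter> {y \<in> topspace S. f y \<in> {..<inverse b}}"
    using q b F by (simp add: f_def H.topspace_eq_carrier)
  ultimately obtain x where x: "x \<in> carrier G" "e x \<in> U'" "f (e x) < inverse b"
    using in_closure_of_meets_open[of q S "e ` carrier G"] dense q by blast
  then have "e x \<in> e ` U"
    using U' by blast
  then obtain x' where x': "x' \<in> U" "e x' = e x"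
    by auto
  then have "x' \<in> T closure_of U"
    using closure_of_subset[OF openin_subset[OF U(1)]] by blast
  then have "inverse (f (e x)) \<le> b"
    using b x' by metis
  moreover have "b < inverse (f (e x))"
    using x b fpos[of x] by (metis inverse_inverse_eq less_imp_inverse_less)
  ultimately show False by simp
qed

section \<open>Transfer between the group and its completion\<close>

theorem theorem4p15:
  fixes G :: "('a, 'c) monoid_scheme" and T :: "'a topology"
    and H :: "('b, 'd) monoid_scheme" and S :: "'b topology"
    and e :: "'a \<Rightarrow> 'b"
  assumes "locally_pseudocompact_group G T"
    and "group_completion G T H S e"
  shows "locally_connected_space T \<longleftrightarrow> locally_connected_space S"
proof -
  interpret group_completion G T H S e by fact
  interpret eh: group_hom G H e
    by unfold_locales (rule hom)
  let ?D = "e ` carrier G"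
  have D: "?D \<subseteq> carrier H"
    by auto
  have "T homeomorphic_space subtopology S ?D"
    using embedding embedding_map_imp_homeomorphic_space[of T S e]
    by (simp add: G.topspace_eq_carrier)
  then have "locally_connected_space T \<longleftrightarrow> locally_connected_space (subtopology S ?D)"
    by (rule homeomorphic_locally_connected_space)
  also have "\<dots> \<longleftrightarrow> locally_connected_space S"
  proof
    have "\<one>\<^bsub>H\<^esub> \<in> ?D"
      using eh.hom_one by (metis G.one_closed image_eqI)
    then show "locally_connected_space (subtopology S ?D) \<Longrightarrow> locally_connected_space S"
      using H.locally_connected_if_dense_subset D dense by blast
    assume lc: "locally_connected_space S"
    show "locally_connected_space (subtopology S ?D)"
      unfolding locally_connected_space
    proof (intro strip)
      fix V x assume "openin (subtopology S ?D) V \<and> x \<in> V"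
      then obtain W where W: "openin S W" "V = W \<inter> ?D" "x \<in> W" "x \<in> ?D"
        by (auto simp: openin_subtopology)
      then obtain U where U: "openin S U" "connectedin S U" "x \<in> U" "U \<subseteq> W"
        using lc unfolding locally_connected_space by meson
      have "connectedin S (U \<inter> ?D)"
        using H.connectedin_Int_G_delta_dense[OF locally_compact dense _ U(1,2)]
          G_delta_dense[OF assms(1)] by blast
      then show "\<exists>U. openin (subtopology S ?D) U \<and> connectedin (subtopology S ?D) U \<and> x \<in> U \<and> U \<subseteq> V"
        using U W by (intro exI[of _ "U \<inter> ?D"]) (auto simp: connectedin_subtopology openin_subtopology)
    qed
  qed
  finally show ?thesis .
qed

end
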